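(* Let $(X,\sigma,\tau)$ be a $2$-permutational solution. Then there exist a unique, up to isomorphism, square-free $2$-reductive solution $(X,L,\mathbf{R})$ and a unique, up to conjugacy, pair of commuting automorphisms $(\pi_1,\pi_2)\in\mathrm{Aut}((X,L,\mathbf{R}))^2$ such that $(X,\sigma,\tau)$ is the $(\pi_1,\pi_2)$-isotope of $(X,L,\mathbf{R})$.
   Context: A solution $(X,\sigma,\tau)$ means a non-degenerate set-theoretic solution of the Yang–Baxter equation: a set $X$ (of arbitrary cardinality) with maps $\sigma,\tau:X^2\to X$, written $\sigma_x(y)=\sigma(x,y)$ and $\tau_y(x)=\tau(x,y)$, such that all $\sigma_x,\tau_y$ are bijections of $X$ and $r(x,y)=(\sigma_x(y),\tau_y(x))$ satisfies the braid relation $(\mathrm{id}\times r)(r\times \mathrm{id})(\mathrm{id}\times r)=(r\times \mathrm{id})(\mathrm{id}\times r)(r\times \mathrm{id})$ on $X^3$. Composition of maps is $(fg)(x)=f(g(x))$. The solution is $2$-permutational if $\sigma_{\sigma_x(z)}=\sigma_{\sigma_y(z)}$, $\tau_{\tau_x(z)}=\tau_{\tau_y(z)}$, $\sigma_{\tau_x(z)}=\sigma_{\tau_y(z)}$, $\tau_{\sigma_x(z)}=\tau_{\sigma_y(z)}$ for all $x,y,z\in X$. It is $2$-reductive if $\sigma_{\sigma_x(y)}=\sigma_y$, $\tau_{\tau_x(y)}=\tau_y$, $\sigma_{\tau_x(y)}=\sigma_y$, $\tau_{\sigma_x(y)}=\tau_y$ for all $x,y\in X$. It is square-free if $r(x,x)=(x,x)$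 for all $x\in X$. An isomorphism from $(X,\sigma,\tau)$ to $(X',\sigma',\tau')$ is a bijection $\Phi:X\to X'$ with $\Phi\sigma_x=\sigma'_{\Phi(x)}\Phi$ and $\Phi\tau_x=\tau'_{\Phi(x)}\Phi$ for all $x\in X$; an automorphism is an isomorphism of a solution to itself, and $\mathrm{Aut}$ denotes the group of automorphisms. For a solution $(X,L,\mathbf{R})$ and bijections $\pi_1,\pi_2:X\to X$, put $\mu_x=L_x\pi_1$, $\nu_x=\mathbf{R}_x\pi_2$. If $(X,\mu,\nu)$ is again a solution, it is called the $(\pi_1,\pi_2)$-isotope of $(X,L,\mathbf{R})$. The uniqueness up to isomorphism and conjugacy means: if $(X,L',\mathbf{R}')$ with $(\pi_1',\pi_2')$ is another such choice, then there is an isomorphism $\varphi$ from $(X,L,\mathbf{R})$ onto $(X,L',\mathbf{R}')$ with $\pi_1'=\varphi\pi_1\varphi^{-1}$ and $\pi_2'=\varphi\pi_2\varphi^{-1}$. *)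

theory Defs
  imports Main
begin

text \<open>
  A pair of families of maps on a carrier set \<open>X\<close> is given by two curried functions whose
  \<^emph>\<open>first\<close> argument is always the subscript: \<open>\<sigma> x y\<close> is $\sigma_x(y)$ and \<open>\<tau> y x\<close> is
  $\tau_y(x)$, i.e. \<open>\<tau> y x\<close> is the value of the two-variable map $\tau$ at $(x,y)$.
  Values outside \<open>X\<close> are irrelevant, and \<open>X\<close> may be empty or infinite.
\<close>

definition yb_map :: "('a \<Rightarrow> 'a \<Rightarrow> 'a) \<Rightarrow> ('a \<Rightarrow> 'a \<Rightarrow> 'a) \<Rightarrow> 'a \<times> 'a \<Rightarrow> 'a \<times> 'a" where
  "yb_map \<sigma> \<tau> = (\<lambda>(x, y). (\<sigma> x y, \<tau> y x))"

definition times_id :: "('a \<times> 'a \<Rightarrow> 'a \<times> 'a) \<Rightarrow> 'a \<times> 'a \<times> 'a \<Rightarrow> 'a \<times> 'a \<times> 'a" where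
  "times_id r = (\<lambda>(x, y, z). let (u, v) = r (x, y) in (u, v, z))"

definition id_times :: "('a \<times> 'a \<Rightarrow> 'a \<times> 'a) \<Rightarrow> 'a \<times> 'a \<times> 'a \<Rightarrow> 'a \<times> 'a \<times> 'a" where
  "id_times r = (\<lambda>(x, y, z). (x, r (y, z)))"

definition yb_solution :: "'a set \<Rightarrow> ('a \<Rightarrow> 'a \<Rightarrow> 'a) \<Rightarrow> ('a \<Rightarrow> 'a \<Rightarrow> 'a) \<Rightarrow> bool" where
  "yb_solution X \<sigma> \<tau> \<longleftrightarrow>
     (\<forall>x\<in>X. bij_betw (\<sigma> x) X X) \<and> (\<forall>y\<in>X. bij_betw (\<tau> y) X X) \<and>
     (let r = yb_map \<sigma> \<tau> in
       \<forall>p \<in> X \<times> X \<times> X.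
         (id_times r \<circ> times_id r \<circ> id_times r) p = (times_id r \<circ> id_times r \<circ> times_id r) p)"

definition two_permutational :: "'a set \<Rightarrow> ('a \<Rightarrow> 'a \<Rightarrow> 'a) \<Rightarrow> ('a \<Rightarrow> 'a \<Rightarrow> 'a) \<Rightarrow> bool" where
  "two_permutational X \<sigma> \<tau> \<longleftrightarrow>
     (\<forall>x\<in>X. \<forall>y\<in>X. \<forall>z\<in>X. \<forall>w\<in>X.
        \<sigma> (\<sigma> x z) w = \<sigma> (\<sigma> y z) w \<and> \<tau> (\<tau> x z) w = \<tau> (\<tau> y z) w \<and>
        \<sigma> (\<tau> x z) w = \<sigma> (\<tau> y z) w \<and> \<tau> (\<sigma> x z) w = \<tau> (\<sigma> y z) w)"

definition two_reductive :: "'a set \<Rightarrow> ('a \<Rightarrow> 'a \<Rightarrow> 'a) \<Rightarrow> ('a \<Rightarrow> 'a \<Rightarrow> 'a) \<Rightarrow> bool" where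
  "two_reductive X \<sigma> \<tau> \<longleftrightarrow>
     (\<forall>x\<in>X. \<forall>y\<in>X. \<forall>w\<in>X.
        \<sigma> (\<sigma> x y) w = \<sigma> y w \<and> \<tau> (\<tau> x y) w = \<tau> y w \<and>
        \<sigma> (\<tau> x y) w = \<sigma> y w \<and> \<tau> (\<sigma> x y) w = \<tau> y w)"

definition square_free :: "'a set \<Rightarrow> ('a \<Rightarrow> 'a \<Rightarrow> 'a) \<Rightarrow> ('a \<Rightarrow> 'a \<Rightarrow> 'a) \<Rightarrow> bool" where
  "square_free X \<sigma> \<tau> \<longleftrightarrow> (\<forall>x\<in>X. yb_map \<sigma> \<tau> (x, x) = (x, x))"

definition yb_iso ::
  "'a set \<Rightarrow> ('a \<Rightarrow> 'a \<Rightarrow> 'a) \<Rightarrow> ('a \<Rightarrow> 'a \<Rightarrow> 'a) \<Rightarrow>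
   'b set \<Rightarrow> ('b \<Rightarrow> 'b \<Rightarrow> 'b) \<Rightarrow> ('b \<Rightarrow> 'b \<Rightarrow> 'b) \<Rightarrow> ('a \<Rightarrow> 'b) \<Rightarrow> bool" where
  "yb_iso X \<sigma> \<tau> X' \<sigma>' \<tau>' \<Phi> \<longleftrightarrow>
     bij_betw \<Phi> X X' \<and>
     (\<forall>x\<in>X. \<forall>y\<in>X. \<Phi> (\<sigma> x y) = \<sigma>' (\<Phi> x) (\<Phi> y) \<and> \<Phi> (\<tau> x y) = \<tau>' (\<Phi> x) (\<Phi> y))"

definition yb_Aut :: "'a set \<Rightarrow> ('a \<Rightarrow> 'a \<Rightarrow> 'a) \<Rightarrow> ('a \<Rightarrow> 'a \<Rightarrow> 'a) \<Rightarrow> ('a \<Rightarrow> 'a) set" where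
  "yb_Aut X \<sigma> \<tau> = {\<Phi>. yb_iso X \<sigma> \<tau> X \<sigma> \<tau> \<Phi>}"

text \<open>\<open>is_isotope X \<sigma> \<tau> L R \<pi>\<^sub>1 \<pi>\<^sub>2\<close>: the solution \<open>(X, \<sigma>, \<tau>)\<close> is the
  \<open>(\<pi>\<^sub>1, \<pi>\<^sub>2)\<close>-isotope of the solution \<open>(X, L, R)\<close>.\<close>

definition is_isotope ::
  "'a set \<Rightarrow> ('a \<Rightarrow> 'a \<Rightarrow> 'a) \<Rightarrow> ('a \<Rightarrow> 'a \<Rightarrow> 'a) \<Rightarrow>
   ('a \<Rightarrow> 'a \<Rightarrow> 'a) \<Rightarrow> ('a \<Rightarrow> 'a \<Rightarrow> 'a) \<Rightarrow> ('a \<Rightarrow> 'a) \<Rightarrow> ('a \<Rightarrow> 'a) \<Rightarrow> bool" where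
  "is_isotope X \<sigma> \<tau> L R \<pi>\<^sub>1 \<pi>\<^sub>2 \<longleftrightarrow>
     yb_solution X L R \<and> bij_betw \<pi>\<^sub>1 X X \<and> bij_betw \<pi>\<^sub>2 X X \<and>
     yb_solution X \<sigma> \<tau> \<and>
     (\<forall>x\<in>X. \<forall>y\<in>X. \<sigma> x y = L x (\<pi>\<^sub>1 y) \<and> \<tau> x y = R x (\<pi>\<^sub>2 y))"

definition square_free_reductive_presentation ::
  "'a set \<Rightarrow> ('a \<Rightarrow> 'a \<Rightarrow> 'a) \<Rightarrow> ('a \<Rightarrow> 'a \<Rightarrow> 'a) \<Rightarrow>
   ('a \<Rightarrow> 'a \<Rightarrow> 'a) \<Rightarrow> ('a \<Rightarrow> 'a \<Rightarrow> 'a) \<Rightarrow> ('a \<Rightarrow> 'a) \<Rightarrow> ('a \<Rightarrow> 'a) \<Rightarrow> bool" where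
  "square_free_reductive_presentation X \<sigma> \<tau> L R \<pi>\<^sub>1 \<pi>\<^sub>2 \<longleftrightarrow>
     yb_solution X L R \<and> square_free X L R \<and> two_reductive X L R \<and>
     \<pi>\<^sub>1 \<in> yb_Aut X L R \<and> \<pi>\<^sub>2 \<in> yb_Aut X L R \<and>
     (\<forall>x\<in>X. \<pi>\<^sub>1 (\<pi>\<^sub>2 x) = \<pi>\<^sub>2 (\<pi>\<^sub>1 x)) \<and>
     is_isotope X \<sigma> \<tau> L R \<pi>\<^sub>1 \<pi>\<^sub>2"

end

theory Submission
  imports Defs
begin

text \<open>
  Uniqueness forces the construction. If \<open>\<sigma>\<^sub>x = L\<^sub>x \<pi>\<^sub>1\<close> and \<open>L\<^sub>x(x) = x\<close>, then \<open>\<pi>\<^sub>1\<close> must be the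
  inverse of \<open>x \<mapsto> \<sigma>\<^sub>x\<^sup>-\<^sup>1(x)\<close>; so \<open>\<sigma>\<close> determines \<open>\<pi>\<^sub>1\<close> and hence \<open>L\<close>, and likewise \<open>\<tau>\<close>
  determines \<open>\<pi>\<^sub>2\<close> and \<open>R\<close>. Any two presentations therefore agree on \<open>X\<close>, and the isomorphism between
  them can be taken to be the identity.

  For existence, call \<open>x\<close> and \<open>y\<close> equivalent if \<open>\<sigma>\<^sub>x = \<sigma>\<^sub>y\<close> and \<open>\<tau>\<^sub>x = \<tau>\<^sub>y\<close>. By
  2-permutationality the class of \<open>\<sigma>\<^sub>x(y)\<close> depends on \<open>y\<close> only; write \<open>f(y)\<close> for it, and \<open>g(y)\<close>
  for the class of \<open>\<tau>\<^sub>x(y)\<close>. The braid relation becomes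
  \<open>\<sigma>\<^sub>x \<sigma>\<^sub>y = \<sigma>\<^bsub>f(y)\<^esub> \<sigma>\<^bsub>g(x)\<^esub>\<close>, \<open>\<tau>\<^sub>x \<tau>\<^sub>y = \<tau>\<^bsub>g(y)\<^esub> \<tau>\<^bsub>f(x)\<^esub>\<close>,
  \<open>\<tau>\<^bsub>f(z)\<^esub> \<sigma>\<^sub>x = \<sigma>\<^bsub>g(x)\<^esub> \<tau>\<^sub>z\<close>.
  Putting \<open>x = f(y)\<close> or \<open>y = g(x)\<close> in the first identity and cancelling gives
  \<open>\<sigma>\<^sub>y = \<sigma>\<^bsub>g(f(y))\<^esub>\<close> and \<open>\<sigma>\<^sub>x = \<sigma>\<^bsub>f(g(x))\<^esub>\<close>, and similarly for \<open>\<tau>\<close>: the maps \<open>f\<close> and \<open>g\<close> are mutually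
  inverse on classes.

  An element \<open>x\<close> with \<open>\<sigma>\<^sub>x(u) = x\<close> must lie in the class \<open>f(u)\<close>, whose members all define the
  same map; conversely the value of that map at \<open>u\<close> lies in \<open>f(u)\<close>. So there is exactly one such
  \<open>x\<close>, namely \<open>\<pi>\<^sub>1(u) = \<sigma>\<^bsub>f(u)\<^esub>(u)\<close>. This \<open>\<pi>\<^sub>1\<close> is a permutation acting as \<open>f\<close> on classes
  (\<open>bij_twist\<close>, \<open>class_twist\<close>). Uniqueness of \<open>x\<close>, the three identities and \<open>f g = g f = id\<close> show
  that \<open>\<pi>\<^sub>1\<close> is an automorphism of \<open>(X, \<sigma>, \<tau>)\<close> (\<open>twist_act_same\<close>, \<open>twist_act_other\<close>) and commutes
  with \<open>\<pi>\<^sub>2\<close>; hence it is an automorphism of \<open>(X, L, R)\<close> too. Square-freeness and 2-reductivity of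
  \<open>(X, L, R)\<close> are immediate from the choice of \<open>\<pi>\<^sub>1\<close> and \<open>\<pi>\<^sub>2\<close>. For a 2-reductive pair the braid
  relation only asks that all the maps \<open>L\<^sub>x\<close> and \<open>R\<^sub>y\<close> commute, and the three identities say just
  that once the twists are moved aside.

  Interchanging \<open>\<sigma>\<close> and \<open>\<tau>\<close> interchanges \<open>f\<close> and \<open>g\<close> and preserves all hypotheses, so every fact
  about \<open>\<sigma>\<close> has a mirror image for \<open>\<tau>\<close>.
\<close>

section \<open>The braid relation in components\<close>

lemma yb_solution_iff:
  "yb_solution X \<sigma> \<tau> \<longleftrightarrow>
     (\<forall>x\<in>X. bij_betw (\<sigma> x) X X) \<and> (\<forall>y\<in>X. bij_betw (\<tau> y) X X) \<and>
     (\<forall>x\<in>X. \<forall>y\<in>X. \<forall>z\<in>X.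
        \<sigma> x (\<sigma> y z) = \<sigma> (\<sigma> x y) (\<sigma> (\<tau> y x) z) \<and>
        \<sigma> (\<tau> (\<sigma> y z) x) (\<tau> z y) = \<tau> (\<sigma> (\<tau> y x) z) (\<sigma> x y) \<and>
        \<tau> (\<tau> z y) (\<tau> (\<sigma> y z) x) = \<tau> z (\<tau> y x))"
  by (auto simp: yb_solution_def yb_map_def times_id_def id_times_def)

lemma yb_solution_flip: "yb_solution X \<sigma> \<tau> \<Longrightarrow> yb_solution X \<tau> \<sigma>"
  unfolding yb_solution_iff by metis

lemma two_permutational_flip: "two_permutational X \<sigma> \<tau> \<Longrightarrow> two_permutational X \<tau> \<sigma>"
  unfolding two_permutational_def by (intro ballI conjI) blast+

section \<open>Equivalence classes of subscripts\<close>

text \<open>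
  All elements \<open>\<sigma> x u\<close> with \<open>x \<in> X\<close> are equivalent as subscripts; the diagonal value is a
  representative that needs no choice of \<open>x\<close>.
\<close>

definition diag :: "('a \<Rightarrow> 'a \<Rightarrow> 'a) \<Rightarrow> 'a \<Rightarrow> 'a" where
  "diag \<sigma> u = \<sigma> u u"

locale two_permutational_solution =
  fixes X :: "'a set" and \<sigma> \<tau> :: "'a \<Rightarrow> 'a \<Rightarrow> 'a"
  assumes solution: "yb_solution X \<sigma> \<tau>"
    and permutational: "two_permutational X \<sigma> \<tau>"

sublocale two_permutational_solution \<subseteq> flip: two_permutational_solution X \<tau> \<sigma>
  by unfold_locales
    (simp_all add: solution permutational yb_solution_flip two_permutational_flip)

abbreviation (in two_permutational_solution) f where "f \<equiv> diag \<sigma>"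
abbreviation (in two_permutational_solution) g where "g \<equiv> diag \<tau>"

lemma (in two_permutational_solution) bij: "x \<in> X \<Longrightarrow> bij_betw (\<sigma> x) X X"
  using solution unfolding yb_solution_iff by blast

lemma (in two_permutational_solution) closed [simp]:
  "x \<in> X \<Longrightarrow> y \<in> X \<Longrightarrow> \<sigma> x y \<in> X" "x \<in> X \<Longrightarrow> y \<in> X \<Longrightarrow> \<tau> x y \<in> X"
  using bij flip.bij by (auto dest: bij_betwE)

lemma (in two_permutational_solution) diag_closed [simp]: "u \<in> X \<Longrightarrow> f u \<in> X"
  by (simp add: diag_def)

lemma (in two_permutational_solution) cancel:
  "\<lbrakk>\<sigma> x u = \<sigma> x v; x \<in> X; u \<in> X; v \<in> X\<rbrakk> \<Longrightarrow> u = v"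
  using bij by (auto simp: bij_betw_def dest: inj_onD)

lemma (in two_permutational_solution) class_f:
  assumes "x \<in> X" "z \<in> X" "w \<in> X"
  shows "\<sigma> (\<sigma> x z) w = \<sigma> (f z) w" "\<tau> (\<sigma> x z) w = \<tau> (f z) w"
  using permutational assms unfolding two_permutational_def diag_def by blast+

lemma (in two_permutational_solution) braid_class:
  assumes "x \<in> X" "y \<in> X" "w \<in> X"
  shows "\<sigma> x (\<sigma> y w) = \<sigma> (f y) (\<sigma> (g x) w)"
proof -
  have "\<sigma> x (\<sigma> y w) = \<sigma> (\<sigma> x y) (\<sigma> (\<tau> y x) w)"
    using solution assms unfolding yb_solution_iff by blast
  then show ?thesis
    using assms by (simp add: class_f flip.class_f)
qed

lemma (in two_permutational_solution) braid_mixed: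
  assumes "x \<in> X" "z \<in> X" "w \<in> X"
  shows "\<tau> (f z) (\<sigma> x w) = \<sigma> (g x) (\<tau> z w)"
proof -
  have "\<sigma> (\<tau> (\<sigma> w z) x) (\<tau> z w) = \<tau> (\<sigma> (\<tau> w x) z) (\<sigma> x w)"
    using solution assms unfolding yb_solution_iff by blast
  then show ?thesis
    using assms by (simp add: class_f flip.class_f)
qed

text \<open>
  In the braid identity, taking \<open>x = f y\<close> makes the outer factors on both sides equal; taking
  \<open>g y\<close> for the second subscript makes the inner factors equal.
\<close>

lemma (in two_permutational_solution) class_inverse:
  assumes "y \<in> X" "w \<in> X"
  shows "\<sigma> (g (f y)) w = \<sigma> y w" "\<sigma> (f (g y)) w = \<sigma> y w"
proof -
  show "\<sigma> (g (f y)) w = \<sigma> y w"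
    using braid_class[of "f y" y w] assms by (auto intro: cancel[of "f y"])
  obtain v where v: "v \<in> X" "w = \<sigma> (g y) v"
    using bij[of "g y"] assms by (auto simp: bij_betw_def)
  then show "\<sigma> (f (g y)) w = \<sigma> y w"
    using braid_class[of y "g y" v] assms by simp
qed

section \<open>The twisting permutations\<close>

text \<open>
  This is \<open>\<pi>\<^sub>1\<close>, the inverse of \<open>x \<mapsto> \<sigma>\<^sub>x\<^sup>-\<^sup>1(x)\<close>; for \<open>\<tau>\<close> it is \<open>\<pi>\<^sub>2\<close>.
\<close>

definition twist :: "('a \<Rightarrow> 'a \<Rightarrow> 'a) \<Rightarrow> 'a \<Rightarrow> 'a" where
  "twist \<sigma> u = \<sigma> (diag \<sigma> u) u"

text \<open>
  Equality \<open>\<sigma> x u = x\<close> puts \<open>x\<close> in the class of \<open>f u\<close>, so \<open>x = \<sigma> x u\<close> can only be the value of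
  \<open>\<sigma> (f u)\<close> at \<open>u\<close>. To evaluate \<open>twist\<close> at an element it is
  thus enough to exhibit a candidate \<open>x\<close>.
\<close>

lemma (in two_permutational_solution) twist_eqI:
  assumes "\<sigma> x u = x" "x \<in> X" "u \<in> X"
  shows "twist \<sigma> u = x"
  using class_f(1)[of x u u] assms by (simp add: twist_def)

lemma (in two_permutational_solution) class_twist:
  assumes "u \<in> X" "w \<in> X"
  shows "\<sigma> (twist \<sigma> u) w = \<sigma> (f u) w" "\<tau> (twist \<sigma> u) w = \<tau> (f u) w"
  using assms unfolding twist_def by (simp_all add: class_f)

lemma (in two_permutational_solution) twist_fixes:
  "u \<in> X \<Longrightarrow> \<sigma> (twist \<sigma> u) u = twist \<sigma> u"
  by (simp add: class_twist) (simp add: twist_def)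

lemma (in two_permutational_solution) twist_closed [simp]:
  "u \<in> X \<Longrightarrow> twist \<sigma> u \<in> X"
  by (simp add: twist_def)

lemma (in two_permutational_solution) bij_twist: "bij_betw (twist \<sigma>) X X"
proof -
  have "inj_on (twist \<sigma>) X"
    by (metis inj_onI twist_fixes cancel twist_closed)
  moreover have "x \<in> twist \<sigma> ` X" if x: "x \<in> X" for x
  proof -
    obtain u where "u \<in> X" "\<sigma> x u = x"
      using bij[OF x] x by (metis bij_betw_iff_bijections)
    with x show ?thesis
      by (metis twist_eqI imageI)
  qed
  ultimately show ?thesis
    by (auto simp: bij_betw_def)
qed

lemma (in two_permutational_solution) obtain_untwist:
  assumes "x \<in> X"
  obtains v where "v \<in> X" "x = twist \<sigma> v"
  using bij_twist assms by (auto simp: bij_betw_def)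

text \<open>
  Write \<open>p\<close> for the right-hand side; it suffices that \<open>\<sigma> p (\<sigma> x u) = p\<close>. Here \<open>p\<close> is equivalent
  to \<open>f v\<close> with \<open>v = twist \<sigma> u\<close>, and \<open>x\<close> may be replaced by \<open>g (f x)\<close>. The braid identity then
  brings \<open>v\<close> inside, where \<open>\<sigma> v u = v\<close> absorbs it.
\<close>

lemma (in two_permutational_solution) twist_act_same:
  assumes "x \<in> X" "u \<in> X"
  shows "twist \<sigma> (\<sigma> x u) = \<sigma> (twist \<sigma> x) (twist \<sigma> u)"
proof (rule twist_eqI)
  let ?v = "twist \<sigma> u"
  have "\<sigma> (\<sigma> (twist \<sigma> x) ?v) (\<sigma> x u) = \<sigma> (f ?v) (\<sigma> x u)"
    using assms by (simp add: class_f)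
  also have "\<dots> = \<sigma> (f ?v) (\<sigma> (g (f x)) u)"
    using assms by (simp add: class_inverse)
  also have "\<dots> = \<sigma> (f x) (\<sigma> ?v u)"
    using braid_class[of "f x" ?v u] assms by simp
  also have "\<dots> = \<sigma> (twist \<sigma> x) ?v"
    using assms by (simp add: twist_fixes class_twist(1)[of x])
  finally show "\<sigma> (\<sigma> (twist \<sigma> x) ?v) (\<sigma> x u) = \<sigma> (twist \<sigma> x) ?v" .
qed (use assms in simp_all)

text \<open>
  The same argument, except that the right-hand side is now equivalent to \<open>g v\<close>, so that the
  mixed braid identity applies.
\<close>

lemma (in two_permutational_solution) twist_act_other:
  assumes "x \<in> X" "u \<in> X"
  shows "twist \<sigma> (\<tau> x u) = \<tau> (twist \<sigma> x) (twist \<sigma> u)"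
proof (rule twist_eqI)
  let ?v = "twist \<sigma> u"
  have "\<sigma> (\<tau> (twist \<sigma> x) ?v) (\<tau> x u) = \<sigma> (g ?v) (\<tau> x u)"
    using assms by (simp add: flip.class_f)
  also have "\<dots> = \<tau> (f x) (\<sigma> ?v u)"
    using braid_mixed[of ?v x u] assms by simp
  also have "\<dots> = \<tau> (twist \<sigma> x) ?v"
    using assms by (simp add: twist_fixes class_twist(2)[of x])
  finally show "\<sigma> (\<tau> (twist \<sigma> x) ?v) (\<tau> x u) = \<tau> (twist \<sigma> x) ?v" .
qed (use assms in simp_all)

text \<open>
  Each composite moves past the action by the previous two facts; since \<open>f\<close> and \<open>g\<close> are inverse on
  classes they become \<open>\<tau> u (twist \<sigma> u)\<close> and \<open>\<sigma> u (twist \<tau> u)\<close>, which the mixed braid identity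
  equates.
\<close>

lemma (in two_permutational_solution) twists_commute:
  assumes "u \<in> X"
  shows "twist \<sigma> (twist \<tau> u) = twist \<tau> (twist \<sigma> u)"
proof -
  have "twist \<sigma> (twist \<tau> u) = \<tau> (twist \<sigma> (g u)) (twist \<sigma> u)"
    unfolding twist_def[of \<tau>] using assms by (simp add: twist_act_other)
  also have "\<dots> = \<tau> (f (g u)) (\<sigma> (f u) u)"
    using assms by (simp add: class_twist(2)[of "g u"]) (simp add: twist_def)
  also have "\<dots> = \<sigma> (g (f u)) (\<tau> (g u) u)"
    using assms by (simp add: braid_mixed)
  also have "\<dots> = \<sigma> (twist \<tau> (f u)) (twist \<tau> u)"
    using assms by (simp add: flip.class_twist(2)[of "f u"]) (simp add: twist_def)
  also have "\<dots> = twist \<tau> (twist \<sigma> u)"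
    unfolding twist_def[of \<sigma>] using assms by (simp add: flip.twist_act_other)
  finally show ?thesis .
qed

section \<open>The square-free 2-reductive solution\<close>

text \<open>The maps \<open>L\<^sub>x = \<sigma>\<^sub>x \<pi>\<^sub>1\<^sup>-\<^sup>1\<close>, the only ones with \<open>\<sigma>\<^sub>x = L\<^sub>x \<pi>\<^sub>1\<close>.\<close>

definition untwisted :: "'a set \<Rightarrow> ('a \<Rightarrow> 'a \<Rightarrow> 'a) \<Rightarrow> 'a \<Rightarrow> 'a \<Rightarrow> 'a" where
  "untwisted X \<sigma> x y = \<sigma> x (inv_into X (twist \<sigma>) y)"

abbreviation (in two_permutational_solution) L where "L \<equiv> untwisted X \<sigma>"
abbreviation (in two_permutational_solution) R where "R \<equiv> untwisted X \<tau>"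

text \<open>
  Since every element is a \<open>twist \<sigma> v\<close>, this equation determines \<open>L\<close>; facts about \<open>L\<close> are derived
  from it after such a substitution.
\<close>

lemma (in two_permutational_solution) untwisted_twist [simp]:
  "v \<in> X \<Longrightarrow> untwisted X \<sigma> x (twist \<sigma> v) = \<sigma> x v"
  using bij_twist by (simp add: untwisted_def bij_betw_def)

lemma (in two_permutational_solution) bij_untwisted:
  "x \<in> X \<Longrightarrow> bij_betw (L x) X X"
  using bij_betw_trans[OF bij_betw_inv_into[OF bij_twist] bij]
  by (simp add: untwisted_def[abs_def] comp_def)

lemma (in two_permutational_solution) untwisted_class:
  assumes "x \<in> X" "y \<in> X" "w \<in> X"
  shows "L (L x y) w = L y w" "R (L x y) w = R y w"
proof -
  obtain v where v: "v \<in> X" "y = twist \<sigma> v"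
    using assms obtain_untwist by metis
  obtain w1 where w1: "w1 \<in> X" "w = twist \<sigma> w1"
    using assms obtain_untwist by metis
  obtain w2 where w2: "w2 \<in> X" "w = twist \<tau> w2"
    using assms flip.obtain_untwist by metis
  show "L (L x y) w = L y w"
    using assms v w1 by (simp add: class_f class_twist)
  have "R (L x y) (twist \<tau> w2) = R y (twist \<tau> w2)"
    using assms v w2(1) by (simp add: class_f class_twist)
  with w2(2) show "R (L x y) w = R y w"
    by simp
qed

text \<open>
  Moving both inverse twists to the right turns \<open>L x L y\<close> into \<open>\<sigma> (f a) \<sigma> b\<close>, where \<open>a\<close> and \<open>b\<close>
  are the untwisted \<open>x\<close> and \<open>y\<close>; by the braid identity and \<open>g f = id\<close> this is symmetric in \<open>a\<close>
  and \<open>b\<close>.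
\<close>

lemma (in two_permutational_solution) untwisted_commute_same:
  assumes "x \<in> X" "y \<in> X" "w \<in> X"
  shows "L x (L y w) = L y (L x w)"
proof -
  obtain v where v: "v \<in> X" "w = twist \<sigma> (twist \<sigma> v)"
    using assms obtain_untwist by metis
  have *: "L (twist \<sigma> a) (L (twist \<sigma> b) w) = \<sigma> (f a) (\<sigma> b v)"
    if "a \<in> X" "b \<in> X" for a b
  proof -
    have "L (twist \<sigma> a) (L (twist \<sigma> b) w) = \<sigma> (twist \<sigma> a) (\<sigma> b v)"
      using that v by (simp add: twist_act_same[symmetric])
    also have "\<dots> = \<sigma> (f a) (\<sigma> b v)"
      using that v by (simp add: class_twist)
    finally show ?thesis .
  qed
  obtain a b where ab: "a \<in> X" "x = twist \<sigma> a" "b \<in> X" "y = twist \<sigma> b"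
    using assms obtain_untwist by metis
  have "\<sigma> (f a) (\<sigma> b v) = \<sigma> (f b) (\<sigma> a v)"
    using ab v by (simp add: braid_class[of "f a" b] class_inverse)
  then show ?thesis
    using ab *[of a b] *[of b a] by simp
qed

text \<open>
  The subscript of \<open>L\<close> is untwisted by \<open>twist \<tau>\<close> and that of \<open>R\<close> by \<open>twist \<sigma>\<close>, because \<open>L x\<close> has to
  be moved past the twist that belongs to \<open>R\<close> and conversely. What remains is the mixed braid
  identity.
\<close>

lemma (in two_permutational_solution) untwisted_commute_mixed:
  assumes "x \<in> X" "z \<in> X" "w \<in> X"
  shows "L x (R z w) = R z (L x w)"
proof -
  obtain a where a: "a \<in> X" "x = twist \<tau> a"
    using assms flip.obtain_untwist by metis
  obtain b where b: "b \<in> X" "z = twist \<sigma> b"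
    using assms obtain_untwist by metis
  obtain v where v: "v \<in> X" "w = twist \<sigma> (twist \<tau> v)"
    using assms obtain_untwist flip.obtain_untwist by metis
  have "L x (R z w) = \<sigma> (twist \<tau> a) (\<tau> b v)"
    using a b v by (simp add: twists_commute twist_act_other[symmetric])
  also have "\<dots> = \<tau> (twist \<sigma> b) (\<sigma> a v)"
    using a b v by (simp add: flip.class_twist class_twist braid_mixed)
  also have "\<dots> = R z (L x w)"
    using a b v by (simp add: flip.twist_act_other[symmetric])
  finally show ?thesis .
qed

lemma (in two_permutational_solution) two_reductive_untwisted: "two_reductive X L R"
  unfolding two_reductive_def by (simp add: untwisted_class flip.untwisted_class)

lemma (in two_permutational_solution) untwisted_closed [simp]:
  "x \<in> X \<Longrightarrow> y \<in> X \<Longrightarrow> L x y \<in> X"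
  using bij_untwisted by (auto dest: bij_betwE)

text \<open>
  2-reductivity removes the inner maps from all subscripts of the braid relation, which leaves
  the commutation of the maps.
\<close>

lemma (in two_permutational_solution) yb_solution_untwisted: "yb_solution X L R"
  unfolding yb_solution_iff
  by (simp add: bij_untwisted flip.bij_untwisted untwisted_class flip.untwisted_class
      untwisted_commute_same flip.untwisted_commute_same untwisted_commute_mixed)

lemma (in two_permutational_solution) untwisted_fixes: "x \<in> X \<Longrightarrow> L x x = x"
  by (rule obtain_untwist[of x]) (simp_all add: twist_fixes)

lemma (in two_permutational_solution) twist_in_Aut: "twist \<sigma> \<in> yb_Aut X L R"
proof -
  have "twist \<sigma> (L x y) = L (twist \<sigma> x) (twist \<sigma> y)"
    if xy: "x \<in> X" "y \<in> X" for x y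
  proof -
    obtain v where "v \<in> X" "y = twist \<sigma> v"
      using xy obtain_untwist by metis
    with xy show ?thesis
      by (simp add: twist_act_same)
  qed
  moreover have "twist \<sigma> (R x y) = R (twist \<sigma> x) (twist \<sigma> y)"
    if xy: "x \<in> X" "y \<in> X" for x y
  proof -
    obtain v where "v \<in> X" "y = twist \<tau> v"
      using xy flip.obtain_untwist by metis
    with xy show ?thesis
      by (simp add: twist_act_other twists_commute)
  qed
  ultimately show ?thesis
    by (simp add: yb_Aut_def yb_iso_def bij_twist)
qed

section \<open>Existence and uniqueness of the presentation\<close>

text \<open>The diagonal condition gives \<open>\<sigma> (p y) y = M (p y) (p y) = p y\<close>, so \<open>p\<close> is \<open>twist \<sigma>\<close>.\<close>

lemma (in two_permutational_solution) isotopy_unique: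
  assumes "\<And>x. x \<in> X \<Longrightarrow> M x x = x" "bij_betw p X X"
    and "\<And>x y. \<lbrakk>x \<in> X; y \<in> X\<rbrakk> \<Longrightarrow> \<sigma> x y = M x (p y)"
  shows "\<forall>x\<in>X. p x = twist \<sigma> x" "\<forall>x\<in>X. \<forall>y\<in>X. M x y = L x y"
proof -
  show p: "\<forall>x\<in>X. p x = twist \<sigma> x"
    using assms by (metis bij_betwE twist_eqI)
  show "\<forall>x\<in>X. \<forall>y\<in>X. M x y = L x y"
    using assms(3) p by (metis obtain_untwist untwisted_twist)
qed

lemma (in two_permutational_solution) presentation_exists:
  "square_free_reductive_presentation X \<sigma> \<tau> L R (twist \<sigma>) (twist \<tau>)"
  unfolding square_free_reductive_presentation_def is_isotope_def square_free_def yb_map_def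
  using twist_in_Aut flip.twist_in_Aut
  by (simp add: yb_solution_untwisted two_reductive_untwisted untwisted_fixes
      flip.untwisted_fixes bij_twist flip.bij_twist solution twists_commute
      yb_Aut_def yb_iso_def)

lemma (in two_permutational_solution) presentation_unique:
  assumes "square_free_reductive_presentation X \<sigma> \<tau> L' R' p q"
  shows "\<forall>x\<in>X. p x = twist \<sigma> x \<and> q x = twist \<tau> x"
    "\<forall>x\<in>X. \<forall>y\<in>X. L' x y = L x y \<and> R' x y = R x y"
proof -
  have L': "\<And>x. x \<in> X \<Longrightarrow> L' x x = x" "bij_betw p X X"
      "\<And>x y. \<lbrakk>x \<in> X; y \<in> X\<rbrakk> \<Longrightarrow> \<sigma> x y = L' x (p y)"
    and R': "\<And>x. x \<in> X \<Longrightarrow> R' x x = x" "bij_betw q X X"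
      "\<And>x y. \<lbrakk>x \<in> X; y \<in> X\<rbrakk> \<Longrightarrow> \<tau> x y = R' x (q y)"
    using assms unfolding square_free_reductive_presentation_def is_isotope_def
      square_free_def yb_map_def by auto
  show "\<forall>x\<in>X. p x = twist \<sigma> x \<and> q x = twist \<tau> x"
    "\<forall>x\<in>X. \<forall>y\<in>X. L' x y = L x y \<and> R' x y = R x y"
    using isotopy_unique[of L' p, OF L'] flip.isotopy_unique[of R' q, OF R'] by simp_all
qed

theorem theorem5p8:
  fixes X :: "'a set" and \<sigma> \<tau> :: "'a \<Rightarrow> 'a \<Rightarrow> 'a"
  assumes "yb_solution X \<sigma> \<tau>" and "two_permutational X \<sigma> \<tau>"
  shows "\<exists>L R \<pi>\<^sub>1 \<pi>\<^sub>2.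
    square_free_reductive_presentation X \<sigma> \<tau> L R \<pi>\<^sub>1 \<pi>\<^sub>2 \<and>
    (\<forall>L' R' \<pi>\<^sub>1' \<pi>\<^sub>2'.
       square_free_reductive_presentation X \<sigma> \<tau> L' R' \<pi>\<^sub>1' \<pi>\<^sub>2' \<longrightarrow>
       (\<exists>\<phi>. yb_iso X L R X L' R' \<phi> \<and>
          (\<forall>x\<in>X. \<pi>\<^sub>1' x = \<phi> (\<pi>\<^sub>1 (inv_into X \<phi> x)) \<and>
                 \<pi>\<^sub>2' x = \<phi> (\<pi>\<^sub>2 (inv_into X \<phi> x)))))"
proof -
  interpret two_permutational_solution X \<sigma> \<tau>
    using assms by unfold_locales
  have "\<exists>\<phi>. yb_iso X L R X L' R' \<phi> \<and>
      (\<forall>x\<in>X. p x = \<phi> (twist \<sigma> (inv_into X \<phi> x)) \<and> q x = \<phi> (twist \<tau> (inv_into X \<phi> x)))"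
    if "square_free_reductive_presentation X \<sigma> \<tau> L' R' p q" for L' R' p q
  proof (intro exI conjI)
    show "yb_iso X L R X L' R' id"
      using presentation_unique(2)[OF that] by (simp add: yb_iso_def)
    have "inv_into X id x = x" if "x \<in> X" for x
      using inv_into_f_f[of id X x] that by simp
    then show "\<forall>x\<in>X. p x = id (twist \<sigma> (inv_into X id x)) \<and> q x = id (twist \<tau> (inv_into X id x))"
      using presentation_unique(1)[OF that] by simp
  qed
  with presentation_exists show ?thesis
    by blast
qed

end
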